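(* Let $G$ be a graph, $S\subseteq V(G)$, and $H=G[S]$. Let $uv\in E(G)$. Then $uv$ is $H$-critical for $S$ if and only if either (1) both $u,v\in S$, or (2) exactly one endpoint, say $v$, lies in $S$, and $u$ is not a corner dominated by $v$ in the induced subgraph $G[S\cup\{u\}]$ (that is, the closed neighbourhood of $u$ in $G[S\cup\{u\}]$ is not contained in the closed neighbourhood of $v$ in $G[S\cup\{u\}]$).
   Context: All graphs are finite and simple. For an edge $uv$ of $G$, the contraction $G/uv$ is obtained by deleting $u,v$ and adding a new vertex $w$ adjacent to every vertex of $(N(u)\cup N(v))\setminus\{u,v\}$. Define $f:2^{V(G)}\to 2^{V(G/uv)}$ by $f(S)=S$ if $u,v\notin S$ and $f(S)=(S\cup\{w\})\setminus\{u,v\}$ otherwise. For $S\subseteq V(G)$ with $G[S]\cong H$, the edge $uv$ is $H$-critical for $S$ if the induced subgraph $(G/uv)[f(S)]$ is not isomorphic to $H$. *)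

theory Defs
  imports "Graph_Theory.Graph_Theory"
begin

text \<open>
  A finite simple graph is a \<^locale>\<open>pair_graph\<close>: finite, symmetric and loop-free, with the
  edge \<open>uv\<close> represented by the two arcs \<open>(u, v)\<close> and \<open>(v, u)\<close>.  Graph isomorphism is
  \<^const>\<open>digraph_iso\<close>, and \<open>G[S]\<close> is \<open>G \<restriction> S\<close>.
\<close>

definition neighbourhood :: "('a, 'b) pre_digraph \<Rightarrow> 'a \<Rightarrow> 'a set" where
  "neighbourhood G u = {x. u \<rightarrow>\<^bsub>G\<^esub> x}"

definition closed_neighbourhood :: "('a, 'b) pre_digraph \<Rightarrow> 'a \<Rightarrow> 'a set" where
  "closed_neighbourhood G u = insert u (neighbourhood G u)"

definition corner_dominated_by :: "('a, 'b) pre_digraph \<Rightarrow> 'a \<Rightarrow> 'a \<Rightarrow> bool" where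
  "corner_dominated_by G u v \<longleftrightarrow> closed_neighbourhood G u \<subseteq> closed_neighbourhood G v"

text \<open>
  The contraction \<open>G/uv\<close> lives on \<open>'a option\<close>: an old vertex \<open>x\<close> becomes \<open>Some x\<close>, and the new
  vertex \<open>w\<close> is \<open>None\<close>, so that it is fresh even if \<open>G\<close> uses up the whole type.
\<close>

definition contract_edge :: "'a pair_pre_digraph \<Rightarrow> 'a \<Rightarrow> 'a \<Rightarrow> 'a option pair_pre_digraph" where
  "contract_edge G u v =
    (let W = (neighbourhood G u \<union> neighbourhood G v) - {u, v} in
     \<lparr> pverts = insert None (Some ` (pverts G - {u, v})),
       parcs = {(Some x, Some y) | x y. (x, y) \<in> parcs G \<and> x \<notin> {u, v} \<and> y \<notin> {u, v}}
             \<union> {(None, Some x) | x. x \<in> W} \<union> {(Some x, None) | x. x \<in> W} \<rparr>)"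

definition contract_set :: "'a \<Rightarrow> 'a \<Rightarrow> 'a set \<Rightarrow> 'a option set" where
  "contract_set u v S =
    (if u \<notin> S \<and> v \<notin> S then Some ` S else insert None (Some ` (S - {u, v})))"

text \<open>The first three conjuncts record when \<open>H\<close>-criticality of \<open>uv\<close> for \<open>S\<close> is defined at all.\<close>

definition critical_for ::
    "('c, 'd) pre_digraph \<Rightarrow> 'a pair_pre_digraph \<Rightarrow> 'a \<Rightarrow> 'a \<Rightarrow> 'a set \<Rightarrow> bool" where
  "critical_for H G u v S \<longleftrightarrow>
     (u, v) \<in> parcs G \<and> S \<subseteq> pverts G \<and> digraph_iso (G \<restriction> S) H \<and>
     \<not> digraph_iso (contract_edge G u v \<restriction> contract_set u v S) H"

end

theory Submission
  imports Defs
begin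

text \<open>
  Contracting \<open>uv\<close> identifies the two ends.  If both lie in \<open>S\<close>, the induced subgraph loses a
  vertex; if neither does, it is unchanged.  If only \<open>v\<close> lies in \<open>S\<close>, renaming \<open>v\<close> to the new
  vertex embeds \<open>G[S]\<close> as a spanning subgraph of the contracted one, and the arcs gained are those
  from the new vertex to neighbours of \<open>u\<close> in \<open>S\<close> outside the closed neighbourhood of \<open>v\<close>.  There
  are none exactly when \<open>u\<close> is dominated by \<open>v\<close>; otherwise the arc counts differ.
\<close>

text \<open>\<open>digraph_isomorphism\<close> demands well-formedness. It is automatic here, since
  restriction makes \<open>S\<close> the vertex set and keeps only arcs with both ends in
  \<open>S\<close>.\<close>

lemma wf_digraph_induce_subgraph: "wf_digraph (G \<restriction> S)"
  by unfold_locales (auto simp: induce_subgraph_def)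

lemma digraph_iso_card_eq:
  assumes "digraph_iso G H"
  shows "card (verts G) = card (verts H)" and "card (arcs G) = card (arcs H)"
  using assms
  by (auto simp: digraph_iso_def pre_digraph.digraph_isomorphism_def card_image)

text \<open>Arcs are ordered pairs, so a vertex bijection forces the arc map
  \<open>map_prod f f\<close>. Finding an isomorphism thus reduces to comparing adjacency on
  \<open>S\<close>.\<close>

lemma digraph_iso_inducedI:
  fixes G :: "'a pair_pre_digraph" and K :: "'b pair_pre_digraph"
  assumes bij: "bij_betw f S T"
    and arcs: "\<And>x y. x \<in> S \<Longrightarrow> y \<in> S \<Longrightarrow> (f x, f y) \<in> parcs K \<longleftrightarrow> (x, y) \<in> parcs G"
  shows "digraph_iso (G \<restriction> S) (K \<restriction> T)"
proof -
  define h :: "('a, 'a \<times> 'a, 'b, 'b \<times> 'b) digraph_isomorphism"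
    where "h = \<lparr>iso_verts = f, iso_arcs = map_prod f f, iso_head = snd, iso_tail = fst\<rparr>"
  have inj: "inj_on f S" and img: "f ` S = T"
    using bij by (auto simp: bij_betw_def)
  have "inj_on (map_prod f f) (S \<times> S)"
    using inj by (simp add: map_prod_inj_on)
  then have "inj_on (map_prod f f) (arcs (G \<restriction> S))"
    by (rule inj_on_subset) auto
  then have "pre_digraph.digraph_isomorphism (G \<restriction> S) h"
    using inj wf_digraph_induce_subgraph[of G S]
    by (auto simp: pre_digraph.digraph_isomorphism_def h_def)
  moreover have "K \<restriction> T = app_iso h (G \<restriction> S)"
  proof (rule pre_digraph.equality)
    show "arcs (K \<restriction> T) = arcs (app_iso h (G \<restriction> S))"
    proof (intro set_eqI iffI)
      fix e assume "e \<in> arcs (K \<restriction> T)"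
      then obtain x y where "x \<in> S" "y \<in> S" "e = (f x, f y)" "e \<in> parcs K"
        unfolding img[symmetric] by (cases e) auto
      then show "e \<in> arcs (app_iso h (G \<restriction> S))"
        using arcs by (auto simp: h_def intro!: image_eqI[of _ _ "(x, y)"])
    next
      fix e assume "e \<in> arcs (app_iso h (G \<restriction> S))"
      then show "e \<in> arcs (K \<restriction> T)"
        using arcs img by (auto simp: h_def)
    qed
  qed (simp_all add: h_def img)
  ultimately show ?thesis
    unfolding digraph_iso_def by blast
qed

lemma digraph_iso_induced_refl:
  fixes G :: "'a pair_pre_digraph"
  shows "digraph_iso (G \<restriction> S) (G \<restriction> S)"
  by (rule digraph_iso_inducedI[of id]) auto

lemma contract_edge_commute: "contract_edge G u v = contract_edge G v u"
  by (simp add: contract_edge_def insert_commute Un_commute conj_commute)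

lemma contract_set_commute: "contract_set u v S = contract_set v u S"
  by (simp add: contract_set_def insert_commute conj_commute)

text \<open>Arcs in both directions at \<open>None\<close> are expressed by arcs leaving
  \<open>u\<close> or \<open>v\<close>, so uses for arcs into \<open>None\<close> rely on the
  symmetry of \<open>G\<close>.\<close>

lemma parcs_contract_edge:
  "(Some x, Some y) \<in> parcs (contract_edge G u v) \<longleftrightarrow>
    (x, y) \<in> parcs G \<and> x \<notin> {u, v} \<and> y \<notin> {u, v}"
  "(None, Some x) \<in> parcs (contract_edge G u v) \<longleftrightarrow>
    ((u, x) \<in> parcs G \<or> (v, x) \<in> parcs G) \<and> x \<notin> {u, v}"
  "(Some x, None) \<in> parcs (contract_edge G u v) \<longleftrightarrow>
    ((u, x) \<in> parcs G \<or> (v, x) \<in> parcs G) \<and> x \<notin> {u, v}"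
  "(None, None) \<notin> parcs (contract_edge G u v)"
  by (auto simp: contract_edge_def neighbourhood_def Let_def)

context pair_graph
begin

text \<open>By symmetry \<open>u\<close> is itself a neighbour of \<open>v\<close>, which leaves
  only the neighbours of \<open>u\<close> in \<open>S\<close> to be checked.\<close>

lemma corner_dominated_by_induced_iff:
  assumes "(u, v) \<in> parcs G" and "v \<in> S"
  shows "corner_dominated_by (G \<restriction> (S \<union> {u})) u v \<longleftrightarrow>
    (\<forall>x\<in>S. (u, x) \<in> parcs G \<longrightarrow> x = v \<or> (v, x) \<in> parcs G)"
proof -
  have dominates: "x \<rightarrow>\<^bsub>G \<restriction> T\<^esub> y \<longleftrightarrow> (x, y) \<in> parcs G \<and> x \<in> T \<and> y \<in> T" for x y T
    by (auto simp: induce_subgraph_def arcs_ends_def arc_to_ends_def)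
  show ?thesis
    using assms no_loops' arcs_symmetric
    unfolding corner_dominated_by_def closed_neighbourhood_def neighbourhood_def dominates
    by blast
qed

lemma not_iso_contract_both:
  assumes "S \<subseteq> pverts G" and "(u, v) \<in> parcs G" and "u \<in> S" and "v \<in> S"
  shows "\<not> digraph_iso (contract_edge G u v \<restriction> contract_set u v S) (G \<restriction> S)"
proof
  assume "digraph_iso (contract_edge G u v \<restriction> contract_set u v S) (G \<restriction> S)"
  then have "card (contract_set u v S) = card S"
    using digraph_iso_card_eq(1) by fastforce
  moreover have "finite S"
    using assms(1) pair_finite_verts by (rule finite_subset)
  moreover have "u \<noteq> v"
    using assms(2) no_loops' by blast
  \<comment> \<open>The bound 2 \<le> \<open>card S\<close> rules out truncation in
    \<open>card S - 2\<close>, so that \<open>Suc (card S - 2)\<close> really differs from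
    \<open>card S\<close>.\<close>
  ultimately show False
    using assms card_mono[of S "{u, v}"]
    by (simp add: contract_set_def card_image card_Diff_subset)
qed

lemma iso_contract_neither:
  assumes "u \<notin> S" and "v \<notin> S"
  shows "digraph_iso (contract_edge G u v \<restriction> contract_set u v S) (G \<restriction> S)"
  using assms
  by (intro digraph_iso_inducedI[of the])
    (auto simp: contract_set_def parcs_contract_edge bij_betw_def inj_on_def image_image)

lemma iso_contract_one_iff:
  assumes "S \<subseteq> pverts G" and uv: "(u, v) \<in> parcs G" and u: "u \<notin> S" and v: "v \<in> S"
  shows "digraph_iso (contract_edge G u v \<restriction> contract_set u v S) (G \<restriction> S) \<longleftrightarrow>
    corner_dominated_by (G \<restriction> (S \<union> {u})) u v"
proof -
  let ?K = "contract_edge G u v" and ?T = "contract_set u v S"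
  have T: "?T = insert None (Some ` (S - {v}))"
    using u v by (simp add: contract_set_def insert_commute)
  define g where "g x = (if x = v then None else Some x)" for x
  have inj: "inj g"
    by (auto simp: g_def inj_def split: if_splits)
  show ?thesis
  proof
    assume dom: "corner_dominated_by (G \<restriction> (S \<union> {u})) u v"
    have dom': "\<And>x. x \<in> S \<Longrightarrow> (u, x) \<in> parcs G \<Longrightarrow> x \<noteq> v \<Longrightarrow> (v, x) \<in> parcs G"
      using dom corner_dominated_by_induced_iff[OF uv v] by blast
    \<comment> \<open>This map inverts \<open>g\<close> on \<open>?T\<close>, sending the new vertex
      back to \<open>v\<close>.\<close>
    have "bij_betw (case_option v id) ?T S"
      unfolding T bij_betw_def using v by (auto simp: inj_on_def image_image)
    moreover have "(case_option v id x, case_option v id y) \<in> parcs G \<longleftrightarrow> (x, y) \<in> parcs ?K"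
      if "x \<in> ?T" "y \<in> ?T" for x y
      using that u v dom'[of "the x"] dom'[of "the y"] arcs_symmetric[of v "the x"]
        arcs_symmetric[of "the x" v] no_loops'[of v v] unfolding T
      by (cases x; cases y) (auto simp: parcs_contract_edge)
    ultimately show "digraph_iso (?K \<restriction> ?T) (G \<restriction> S)"
      by (rule digraph_iso_inducedI)
  next
    assume iso: "digraph_iso (?K \<restriction> ?T) (G \<restriction> S)"
    show "corner_dominated_by (G \<restriction> (S \<union> {u})) u v"
    proof (rule ccontr)
      assume "\<not> ?thesis"
      then obtain z where z: "z \<in> S" "(u, z) \<in> parcs G" "z \<noteq> v" "(v, z) \<notin> parcs G"
        using corner_dominated_by_induced_iff[OF uv v] by blast
      \<comment> \<open>Since \<open>u\<close> is outside \<open>S\<close>, every neighbour of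
        \<open>v\<close> in \<open>S\<close> survives the contraction and becomes a neighbour of
        \<open>None\<close>.\<close>
      have "(g x, g y) \<in> parcs ?K \<and> g x \<in> ?T \<and> g y \<in> ?T"
        if "(x, y) \<in> parcs G" "x \<in> S" "y \<in> S" for x y
        using that u no_loops'[of x y] arcs_symmetric[OF that(1)] unfolding T
        by (cases "x = v"; cases "y = v") (auto simp: g_def parcs_contract_edge)
      then have "map_prod g g ` arcs (G \<restriction> S) \<subseteq> arcs (?K \<restriction> ?T)"
        by auto
      moreover have "(None, Some z) \<in> arcs (?K \<restriction> ?T)"
        using z u unfolding T by (auto simp: parcs_contract_edge)
      \<comment> \<open>Its only possible preimage is \<open>(v, z)\<close>, which is not an arc of
        \<open>G\<close>.\<close>
      moreover have "(None, Some z) \<notin> map_prod g g ` arcs (G \<restriction> S)"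
        using z by (auto simp: g_def split: if_splits)
      ultimately have "map_prod g g ` arcs (G \<restriction> S) \<subset> arcs (?K \<restriction> ?T)"
        by blast
      moreover have "finite S"
        using assms(1) pair_finite_verts by (rule finite_subset)
      then have "finite (arcs (?K \<restriction> ?T))"
        by (auto simp: T intro: finite_subset[of _ "?T \<times> ?T"])
      ultimately have "card (map_prod g g ` arcs (G \<restriction> S)) < card (arcs (?K \<restriction> ?T))"
        by (rule psubset_card_mono[rotated])
      moreover have "card (map_prod g g ` arcs (G \<restriction> S)) = card (arcs (G \<restriction> S))"
        by (rule card_image[OF inj_on_subset[OF prod.inj_map[OF inj inj] subset_UNIV]])
      \<comment> \<open>The assumed isomorphism may be unrelated to \<open>g\<close>; equality of
        arc counts already contradicts the strict inequality.\<close>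
      ultimately show False
        using digraph_iso_card_eq(2)[OF iso] by simp
    qed
  qed
qed

end

theorem theorem13:
  fixes G :: "'a pair_pre_digraph" and H :: "('a, 'a \<times> 'a) pre_digraph"
    and S :: "'a set" and u v :: 'a
  assumes "pair_graph G"
    and "S \<subseteq> pverts G"
    and "H = G \<restriction> S"
    and "(u, v) \<in> parcs G"
  shows "critical_for H G u v S \<longleftrightarrow>
      (u \<in> S \<and> v \<in> S)
    \<or> (v \<in> S \<and> u \<notin> S \<and> \<not> corner_dominated_by (G \<restriction> (S \<union> {u})) u v)
    \<or> (u \<in> S \<and> v \<notin> S \<and> \<not> corner_dominated_by (G \<restriction> (S \<union> {v})) v u)"
proof -
  interpret pair_graph G by fact
  have vu: "(v, u) \<in> parcs G"
    using assms(4) by (rule arcs_symmetric)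
  have "critical_for H G u v S \<longleftrightarrow>
      \<not> digraph_iso (contract_edge G u v \<restriction> contract_set u v S) (G \<restriction> S)"
    unfolding critical_for_def \<open>H = G \<restriction> S\<close>
    using assms(2,4) digraph_iso_induced_refl[of G S] by blast
  then show ?thesis
    using not_iso_contract_both[OF assms(2,4)] iso_contract_neither[of u S v]
      iso_contract_one_iff[OF assms(2,4)] iso_contract_one_iff[OF assms(2) vu]
    \<comment> \<open>When only \<open>u\<close> lies in \<open>S\<close>, the one-end lemma is
      applied with the ends exchanged; these rewrites turn its contraction back into that of
      \<open>uv\<close>.\<close>
    unfolding contract_edge_commute[of G v u] contract_set_commute[of v u]
    by blast
qed

end
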